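(* Let $\mathsf{Val}\in\{\mathsf{Inf},\mathsf{Sup}\}$. A nondeterministic $\mathsf{Val}$ automaton on finite words is history deterministic if and only if it is determinizable by pruning.
   Context: For a sequence $v=v_0v_1\ldots$ of rationals, $\mathsf{Inf}(v)=\inf\{v_n : n\ge0\}$ and $\mathsf{Sup}(v)=\sup\{v_n : n\ge0\}$. A nondeterministic quantitative automaton is $\mathcal{A}=(\Sigma,Q,\iota,\delta)$ with finite nonempty alphabet $\Sigma$, finite nonempty state set $Q$, initial state $\iota$, and $\delta:Q\times\Sigma\to 2^{\mathbb{Q}\times Q}$ with finite nonempty values; $(x,q')\in\delta(q,a)$ gives a transition from $q$ to $q'$ over $a$ with weight $x$. It is deterministic if all $\delta(q,a)$ are singletons. A $\mathsf{Val}$ automaton is one equipped with value function $\mathsf{Val}$. A run on a finite word $w$ is a sequence $\pi$ of consecutive transitions from $\iota$ over the letters of $w$; $\mathsf{Val}(\pi)$ is $\mathsf{Val}$ of its weight sequence; $\mathcal{A}(w)$ is the supremum of $\mathsf{Val}(\pi)$ over runs $\pi$ on $w$. Automata are equivalent if they give the same value to each word. **History determinism (nondeterministic case, finite words).** In the letter game on $\mathcal{A}$, starting from $\iota$, in each round Adam picks a letter $a\in\Sigma$ and Eve picks a transition over $a$ from the current state; this produces an infinite word $w$ and an infinite sequence $\pi$ of transitions; Eve wins the play if $\mathsf{Val}(\pi[0..i])\ge\mathcal{A}(w[0..i])$ for all $i$. $\mathcal{A}$ is history deterministic if Eve has a winning strategy (depending on the history of the play). **Determinizability by pruning.** $\mathcal{A}$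 is determinizable by pruning if there is a deterministic $\mathsf{Val}$ automaton equivalent to $\mathcal{A}$ obtained from $\mathcal{A}$ by removing some states and transitions. *)

theory Defs
  imports "HOL-Library.Extended_Real"
begin

text \<open>Values live in \<^typ>\<open>ereal\<close>, so that infima and suprema are total; only on the empty
  sequence do they yield an infinite value.\<close>

definition Inf_val :: "rat list \<Rightarrow> ereal" where
  "Inf_val v = (INF n\<in>{..<length v}. ereal (of_rat (v ! n)))"

definition Sup_val :: "rat list \<Rightarrow> ereal" where
  "Sup_val v = (SUP n\<in>{..<length v}. ereal (of_rat (v ! n)))"

record ('a, 'q) automaton =
  alphabet :: "'a set"
  states :: "'q set"
  initial :: 'q
  delta :: "'q \<Rightarrow> 'a \<Rightarrow> (rat \<times> 'q) set"

text \<open>The values of \<^const>\<open>delta\<close> outside \<open>states \<times> alphabet\<close> are irrelevant: every notion below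
  looks at \<^const>\<open>delta\<close> only on that domain.\<close>

definition quantitative_automaton :: "('a, 'q) automaton \<Rightarrow> bool" where
  "quantitative_automaton \<A> \<longleftrightarrow>
     finite (alphabet \<A>) \<and> alphabet \<A> \<noteq> {} \<and>
     finite (states \<A>) \<and> initial \<A> \<in> states \<A> \<and>
     (\<forall>q\<in>states \<A>. \<forall>a\<in>alphabet \<A>.
        finite (delta \<A> q a) \<and> delta \<A> q a \<noteq> {} \<and> delta \<A> q a \<subseteq> UNIV \<times> states \<A>)"

definition deterministic :: "('a, 'q) automaton \<Rightarrow> bool" where
  "deterministic \<A> \<longleftrightarrow> (\<forall>q\<in>states \<A>. \<forall>a\<in>alphabet \<A>. is_singleton (delta \<A> q a))"

datatype ('a, 'q) transition =
  Transition (source: 'q) (letter: 'a) (weight: rat) (target: 'q)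

definition transitions :: "('a, 'q) automaton \<Rightarrow> ('a, 'q) transition set" where
  "transitions \<A> = {t. source t \<in> states \<A> \<and> letter t \<in> alphabet \<A> \<and>
     (weight t, target t) \<in> delta \<A> (source t) (letter t)}"

fun run_from :: "('a, 'q) automaton \<Rightarrow> 'q \<Rightarrow> 'a list \<Rightarrow> ('a, 'q) transition list \<Rightarrow> bool" where
  "run_from \<A> q [] [] \<longleftrightarrow> True"
| "run_from \<A> q (a # w) (t # \<pi>) \<longleftrightarrow>
     t \<in> transitions \<A> \<and> source t = q \<and> letter t = a \<and> run_from \<A> (target t) w \<pi>"
| "run_from \<A> q _ _ \<longleftrightarrow> False"

definition is_run :: "('a, 'q) automaton \<Rightarrow> 'a list \<Rightarrow> ('a, 'q) transition list \<Rightarrow> bool" where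
  "is_run \<A> w \<pi> \<longleftrightarrow> run_from \<A> (initial \<A>) w \<pi>"

definition run_value :: "(rat list \<Rightarrow> ereal) \<Rightarrow> ('a, 'q) transition list \<Rightarrow> ereal" where
  "run_value Val \<pi> = Val (map weight \<pi>)"

definition word_value :: "(rat list \<Rightarrow> ereal) \<Rightarrow> ('a, 'q) automaton \<Rightarrow> 'a list \<Rightarrow> ereal" where
  "word_value Val \<A> w = (SUP \<pi>\<in>{\<pi>. is_run \<A> w \<pi>}. run_value Val \<pi>)"

definition equivalent ::
    "(rat list \<Rightarrow> ereal) \<Rightarrow> ('a, 'q) automaton \<Rightarrow> ('a, 'p) automaton \<Rightarrow> bool" where
  "equivalent Val \<A> \<B> \<longleftrightarrow> alphabet \<A> = alphabet \<B> \<and>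
     (\<forall>w\<in>lists (alphabet \<A>). word_value Val \<A> w = word_value Val \<B> w)"

text \<open>A strategy of Eve maps the history, i.e. the transitions taken so far (which carry the letters
  played so far), and the letter just picked by Adam to a transition.\<close>

type_synonym ('a, 'q) strategy = "('a, 'q) transition list \<Rightarrow> 'a \<Rightarrow> ('a, 'q) transition"

text \<open>The infinite sequence of transitions produced when Adam plays the infinite word \<open>w\<close> and Eve
  follows \<open>\<sigma>\<close>.\<close>

function outcome :: "('a, 'q) strategy \<Rightarrow> (nat \<Rightarrow> 'a) \<Rightarrow> nat \<Rightarrow> ('a, 'q) transition" where
  "outcome \<sigma> w n = \<sigma> (map (outcome \<sigma> w) [0..<n]) (w n)"
  by pat_completeness auto
termination by (relation "measure (\<lambda>(\<sigma>, w, n). n)") auto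

declare outcome.simps [simp del]

text \<open>The \<^const>\<open>is_run\<close> conjunct says that Eve's choices are legal moves. A strategy may take
  arbitrary values on histories that it never produces.\<close>

definition winning_strategy ::
    "(rat list \<Rightarrow> ereal) \<Rightarrow> ('a, 'q) automaton \<Rightarrow> ('a, 'q) strategy \<Rightarrow> bool" where
  "winning_strategy Val \<A> \<sigma> \<longleftrightarrow>
     (\<forall>w. range w \<subseteq> alphabet \<A> \<longrightarrow>
        (\<forall>i. let u = map w [0..<Suc i]; \<pi> = map (outcome \<sigma> w) [0..<Suc i]
             in is_run \<A> u \<pi> \<and> run_value Val \<pi> \<ge> word_value Val \<A> u))"

definition history_deterministic ::
    "(rat list \<Rightarrow> ereal) \<Rightarrow> ('a, 'q) automaton \<Rightarrow> bool" where
  "history_deterministic Val \<A> \<longleftrightarrow> (\<exists>\<sigma>. winning_strategy Val \<A> \<sigma>)"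

definition pruning_of :: "('a, 'q) automaton \<Rightarrow> ('a, 'q) automaton \<Rightarrow> bool" where
  "pruning_of \<B> \<A> \<longleftrightarrow> quantitative_automaton \<B> \<and>
     alphabet \<B> = alphabet \<A> \<and> initial \<B> = initial \<A> \<and>
     states \<B> \<subseteq> states \<A> \<and> transitions \<B> \<subseteq> transitions \<A>"

definition determinizable_by_pruning ::
    "(rat list \<Rightarrow> ereal) \<Rightarrow> ('a, 'q) automaton \<Rightarrow> bool" where
  "determinizable_by_pruning Val \<A> \<longleftrightarrow>
     (\<exists>\<B>. pruning_of \<B> \<A> \<and> deterministic \<B> \<and> equivalent Val \<B> \<A>)"

end

theory Submission
  imports Defs
begin

text \<open>A winning strategy is made positional as follows. \<^const>\<open>Inf_val\<close> and \<^const>\<open>Sup_val\<close> both fold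
  a commutative, idempotent, selective and monotone operation \<open>\<odot>\<close> over the weights; order the
  values by \<open>v \<sqsubseteq> v' \<longleftrightarrow> v \<odot> v' = v\<close>. For each state \<open>q\<close> that the strategy reaches, among the
  (finitely many) values of histories ending in \<open>q\<close> let \<open>V q\<close> be the \<open>\<sqsubseteq>\<close>-greatest, and always
  play from \<open>q\<close> as the strategy does after a history of value \<open>V q\<close>. Any inequality
  \<open>V q \<odot> x \<le> V q \<odot> y\<close> guaranteed by the strategy persists for all \<open>v \<sqsubseteq> V q\<close>, and the invariant
  \<open>v \<sqsubseteq> V q\<close> is preserved by the pruned automaton, since \<open>v \<odot> x \<sqsubseteq> V q \<odot> x \<sqsubseteq> V q'\<close> along a
  transition from \<open>q\<close> to \<open>q'\<close> of weight \<open>x\<close>.\<close>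

section \<open>Runs, their end states and the finite set of transitions\<close>

definition end_state :: "'q \<Rightarrow> ('a, 'q) transition list \<Rightarrow> 'q" where
  "end_state q \<pi> = (if \<pi> = [] then q else target (last \<pi>))"

lemma end_state_simps [simp]:
  "end_state q [] = q"
  "end_state q (t # \<pi>) = end_state (target t) \<pi>"
  "end_state q (\<pi> @ [t]) = target t"
  by (auto simp: end_state_def)

lemma run_from_Nil_iff [simp]: "run_from \<A> q [] \<pi> \<longleftrightarrow> \<pi> = []"
  by (cases \<pi>) auto

lemma run_from_Cons_iff:
  "run_from \<A> q (a # w) \<pi> \<longleftrightarrow>
     (\<exists>t \<rho>. \<pi> = t # \<rho> \<and> t \<in> transitions \<A> \<and> source t = q \<and> letter t = a \<and>
       run_from \<A> (target t) w \<rho>)"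
  by (cases \<pi>) auto

lemma run_from_append:
  assumes "length \<pi> = length u"
  shows "run_from \<A> q (u @ w) (\<pi> @ \<rho>) \<longleftrightarrow>
    run_from \<A> q u \<pi> \<and> run_from \<A> (end_state q \<pi>) w \<rho>"
  using assms by (induction \<pi> u arbitrary: q rule: list_induct2) auto

lemma run_from_mono:
  assumes "run_from \<B> q w \<pi>" "transitions \<B> \<subseteq> transitions \<A>"
  shows "run_from \<A> q w \<pi>"
  using assms by (induction \<B> q w \<pi> rule: run_from.induct) auto

lemma run_from_transitions:
  assumes "run_from \<A> q w \<pi>"
  shows "set \<pi> \<subseteq> transitions \<A>"
  using assms by (induction \<A> q w \<pi> rule: run_from.induct) auto

lemma word_value_upper: "is_run \<A> w \<pi> \<Longrightarrow> run_value Val \<pi> \<le> word_value Val \<A> w"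
  unfolding word_value_def by (rule SUP_upper) simp

text \<open>Needed so that histories of unbounded length still take only finitely many values.
  Finiteness of \<open>delta\<close> is known only on states and letters, hence the dependent sum
  \<open>?S\<close>.\<close>

lemma finite_transitions:
  assumes "quantitative_automaton \<A>"
  shows "finite (transitions \<A>)"
proof -
  let ?S = "SIGMA q:states \<A>. SIGMA a:alphabet \<A>. delta \<A> q a"
  have "transitions \<A> \<subseteq> (\<lambda>(q, a, x, q'). Transition q a x q') ` ?S"
  proof
    fix t assume "t \<in> transitions \<A>"
    then have "(source t, letter t, weight t, target t) \<in> ?S"
      by (auto simp: transitions_def)
    then show "t \<in> (\<lambda>(q, a, x, q'). Transition q a x q') ` ?S"
      by (rule rev_image_eqI) simp
  qed
  moreover have "finite ?S"
    using assms by (auto simp: quantitative_automaton_def)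
  ultimately show ?thesis
    by (meson finite_imageI finite_subset)
qed

subsection \<open>Plays on finite words\<close>

text \<open>Finite-word counterpart of \<open>outcome\<close>. The history \<open>h\<close> is a
  parameter so that the continuation after any history is again a play, which suits list induction
  and the splitting of words.\<close>

fun play :: "('a, 'q) strategy \<Rightarrow> ('a, 'q) transition list \<Rightarrow> 'a list \<Rightarrow> ('a, 'q) transition list"
  where
    "play \<sigma> h [] = []"
  | "play \<sigma> h (a # w) = \<sigma> h a # play \<sigma> (h @ [\<sigma> h a]) w"

lemma length_play [simp]: "length (play \<sigma> h w) = length w"
  by (induction \<sigma> h w rule: play.induct) auto

lemma play_append: "play \<sigma> h (u @ w) = play \<sigma> h u @ play \<sigma> (h @ play \<sigma> h u) w"
  by (induction \<sigma> h u rule: play.induct) auto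

lemma map_outcome_eq_play: "map (outcome \<sigma> w) [0..<n] = play \<sigma> [] (map w [0..<n])"
proof (induction n)
  case (Suc n)
  have "outcome \<sigma> w n = \<sigma> (play \<sigma> [] (map w [0..<n])) (w n)"
    by (subst outcome.simps) (simp only: Suc.IH)
  then show ?case
    using Suc.IH by (simp add: play_append)
qed simp

text \<open>Every nonempty finite word is a prefix of an infinite one, padded with a fixed letter;
  this is where nonemptiness of the alphabet enters. On the empty word the only run is the empty
  one.\<close>

lemma winning_strategy_iff_play:
  assumes "alphabet \<A> \<noteq> {}"
  shows "winning_strategy Val \<A> \<sigma> \<longleftrightarrow>
    (\<forall>u\<in>lists (alphabet \<A>). is_run \<A> u (play \<sigma> [] u) \<and>
       word_value Val \<A> u \<le> run_value Val (play \<sigma> [] u))"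
    (is "_ \<longleftrightarrow> (\<forall>u\<in>_. ?good u)")
proof
  assume win: "winning_strategy Val \<A> \<sigma>"
  show "\<forall>u\<in>lists (alphabet \<A>). ?good u"
  proof
    fix u assume u: "u \<in> lists (alphabet \<A>)"
    show "?good u"
    proof (cases "u = []")
      case True
      then show ?thesis
        by (simp add: is_run_def word_value_def)
    next
      case False
      obtain b where b: "b \<in> alphabet \<A>"
        using assms by blast
      define w where "w n = (if n < length u then u ! n else b)" for n
      obtain i where i: "length u = Suc i"
        using False by (cases u) auto
      have "range w \<subseteq> alphabet \<A>"
        using u b by (auto simp: w_def in_lists_conv_set)
      moreover have "map w [0..<Suc i] = u"
        by (rule nth_equalityI) (auto simp: w_def i simp del: upt_Suc)
      ultimately show ?thesis
        using win unfolding winning_strategy_def map_outcome_eq_play Let_def by metis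
    qed
  qed
next
  assume good: "\<forall>u\<in>lists (alphabet \<A>). ?good u"
  have "map w [0..<Suc i] \<in> lists (alphabet \<A>)" if "range w \<subseteq> alphabet \<A>" for w i
    using that by (auto dest: range_subsetD)
  with good show "winning_strategy Val \<A> \<sigma>"
    unfolding winning_strategy_def map_outcome_eq_play Let_def by blast
qed

subsection \<open>Deterministic automata\<close>

lemma deterministic_ex1_transition:
  assumes "deterministic \<B>" "q \<in> states \<B>" "a \<in> alphabet \<B>"
  shows "\<exists>!t. t \<in> transitions \<B> \<and> source t = q \<and> letter t = a"
proof -
  obtain x q' where "delta \<B> q a = {(x, q')}"
    using assms unfolding deterministic_def by (metis is_singletonE surj_pair)
  then show ?thesis
    using assms(2,3)
    by (intro ex1I[of _ "Transition q a x q'"]) (auto simp: transitions_def intro: transition.expand)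
qed

lemma deterministic_run_unique:
  assumes "deterministic \<B>" "run_from \<B> q w \<pi>" "run_from \<B> q w \<rho>"
  shows "\<pi> = \<rho>"
  using assms(2,3)
proof (induction w arbitrary: q \<pi> \<rho>)
  case (Cons a w)
  obtain t \<pi>' where t: "\<pi> = t # \<pi>'" "t \<in> transitions \<B>" "source t = q" "letter t = a"
      "run_from \<B> (target t) w \<pi>'"
    using Cons.prems(1) by (auto simp: run_from_Cons_iff)
  obtain s \<rho>' where s: "\<rho> = s # \<rho>'" "s \<in> transitions \<B>" "source s = q" "letter s = a"
      "run_from \<B> (target s) w \<rho>'"
    using Cons.prems(2) by (auto simp: run_from_Cons_iff)
  have "q \<in> states \<B>" "a \<in> alphabet \<B>"
    using t by (auto simp: transitions_def)
  then have "t = s"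
    using deterministic_ex1_transition[OF assms(1)] t s by blast
  then show ?case
    using Cons.IH t s by blast
qed simp

lemma deterministic_word_value:
  assumes "deterministic \<B>" "is_run \<B> w \<pi>"
  shows "word_value Val \<B> w = run_value Val \<pi>"
proof -
  have "{\<rho>. is_run \<B> w \<rho>} = {\<pi>}"
    using assms deterministic_run_unique unfolding is_run_def by fastforce
  then show ?thesis
    by (simp add: word_value_def)
qed

text \<open>Eve follows the unique run of the pruned automaton. It is a run of \<open>\<A>\<close>
  too, and by uniqueness its value is that of the word in \<open>\<B>\<close>, hence in
  \<open>\<A>\<close> by equivalence.\<close>

lemma history_deterministic_if_determinizable_by_pruning:
  fixes \<A> :: "('a, 'q) automaton"
  assumes "determinizable_by_pruning Val \<A>"
  shows "history_deterministic Val \<A>"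
proof -
  obtain \<B> where prune: "pruning_of \<B> \<A>" and det: "deterministic \<B>"
    and equiv: "equivalent Val \<B> \<A>"
    using assms unfolding determinizable_by_pruning_def by blast
  have quant: "quantitative_automaton \<B>" and alph: "alphabet \<B> = alphabet \<A>"
    and init: "initial \<B> = initial \<A>" and trans: "transitions \<B> \<subseteq> transitions \<A>"
    using prune by (auto simp: pruning_of_def)
  \<comment> \<open>Positional choice: the history matters only through its end state. Determinism
    makes the description unique at states and letters of \<open>\<B>\<close>.\<close>
  define \<sigma> :: "('a, 'q) strategy" where "\<sigma> h a =
    (THE t. t \<in> transitions \<B> \<and> source t = end_state (initial \<B>) h \<and> letter t = a)" for h a
  have run: "run_from \<B> (end_state (initial \<B>) h) w (play \<sigma> h w)"
    if "w \<in> lists (alphabet \<B>)" "end_state (initial \<B>) h \<in> states \<B>" for h w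
    using that
  proof (induction w arbitrary: h rule: list.induct)
    case (Cons a w)
    have "\<exists>!t. t \<in> transitions \<B> \<and> source t = end_state (initial \<B>) h \<and> letter t = a"
      using deterministic_ex1_transition[OF det Cons.prems(2)] Cons.prems(1) by simp
    from theI'[OF this] have t: "\<sigma> h a \<in> transitions \<B> \<and> source (\<sigma> h a) = end_state (initial \<B>) h \<and>
        letter (\<sigma> h a) = a"
      unfolding \<sigma>_def .
    then have "target (\<sigma> h a) \<in> states \<B>"
      using quant by (fastforce simp: transitions_def quantitative_automaton_def)
    then show ?case
      using Cons.IH[of "h @ [\<sigma> h a]"] Cons.prems t by auto
  qed simp
  have "initial \<B> \<in> states \<B>" and nonempty: "alphabet \<B> \<noteq> {}"
    using quant by (auto simp: quantitative_automaton_def)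
  then have "is_run \<B> u (play \<sigma> [] u)" if "u \<in> lists (alphabet \<B>)" for u
    using run[of u "[]"] that by (simp add: is_run_def)
  moreover have "is_run \<A> u \<pi>" if "is_run \<B> u \<pi>" for u \<pi>
    using that run_from_mono trans init unfolding is_run_def by metis
  moreover have "word_value Val \<A> u = run_value Val (play \<sigma> [] u)"
    if "u \<in> lists (alphabet \<B>)" for u
    using equiv that deterministic_word_value[OF det calculation(1)[OF that], of Val]
    by (metis equivalent_def)
  ultimately have "winning_strategy Val \<A> \<sigma>"
    using nonempty alph by (simp add: winning_strategy_iff_play del: in_lists_conv_set)
  then show ?thesis
    unfolding history_deterministic_def by blast
qed

subsection \<open>Selective value functions\<close>

text \<open>Common ground of \<open>min\<close> and \<open>max\<close>. The order \<sqsubseteq> of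
  the introduction is \<le> for \<open>min\<close> and \<ge> for \<open>max\<close>, whereas
  \<open>mono\<close> always refers to the numerical order in which runs compete.\<close>

locale selective_value =
  fixes Val :: "rat list \<Rightarrow> ereal" and comb :: "ereal \<Rightarrow> ereal \<Rightarrow> ereal" (infixl \<open>\<odot>\<close> 70)
  assumes assoc: "x \<odot> y \<odot> z = x \<odot> (y \<odot> z)"
    and commute: "x \<odot> y = y \<odot> x"
    and selective: "x \<odot> y = x \<or> x \<odot> y = y"
    and mono: "y \<le> z \<Longrightarrow> x \<odot> y \<le> x \<odot> z"
    and Nil_neutral: "Val [] \<odot> x = x"
    and Val_Cons: "Val (r # rs) = ereal (of_rat r) \<odot> Val rs"
begin

declare Nil_neutral [simp]

lemma Nil_neutral_right [simp]: "x \<odot> Val [] = x"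
  by (simp add: commute[of x])

lemma run_value_Nil [simp]: "run_value Val [] = Val []"
  by (simp add: run_value_def)

lemma run_value_Cons:
  "run_value Val (t # \<pi>) = ereal (of_rat (weight t)) \<odot> run_value Val \<pi>"
  by (simp add: run_value_def Val_Cons)

lemma run_value_append: "run_value Val (\<pi> @ \<rho>) = run_value Val \<pi> \<odot> run_value Val \<rho>"
  by (induction \<pi>) (auto simp: run_value_Cons assoc)

text \<open>By selectivity, combining weights creates no value beyond the weights themselves and
  \<open>Val []\<close>.\<close>

lemma run_value_in:
  assumes "set \<pi> \<subseteq> T"
  shows "run_value Val \<pi> \<in> insert (Val []) ((\<lambda>t. ereal (of_rat (weight t))) ` T)"
  using assms
proof (induction \<pi>)
  case (Cons t \<pi>)
  then show ?case
    using selective[of "ereal (of_rat (weight t))" "run_value Val \<pi>"]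
    by (auto simp: run_value_Cons)
qed simp

text \<open>Selectivity makes \<sqsubseteq> total and associativity makes it transitive, so a new
  element that is not below the old greatest one lies above all others.\<close>

lemma finite_has_greatest:
  assumes "finite S" "S \<noteq> {}"
  shows "\<exists>m\<in>S. \<forall>s\<in>S. s \<odot> m = s"
  using assms
proof (induction S rule: finite_ne_induct)
  case (singleton x)
  then show ?case using selective by auto
next
  case (insert x F)
  then obtain m where m: "m \<in> F" "\<And>s. s \<in> F \<Longrightarrow> s \<odot> m = s"
    by blast
  show ?case
  proof (cases "x \<odot> m = x")
    case True
    then show ?thesis using m by blast
  next
    case False
    then have "m \<odot> x = m"
      using selective commute by metis
    then have "s \<odot> x = s" if "s \<in> F" for s
      using m(2)[OF that] assoc by metis
    then show ?thesis
      using selective by auto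
  qed
qed

section \<open>From a winning strategy to a deterministic pruning\<close>

lemma determinizable_by_pruning_if_history_deterministic:
  fixes \<A> :: "('a, 'q) automaton"
  assumes quant: "quantitative_automaton \<A>" and "history_deterministic Val \<A>"
  shows "determinizable_by_pruning Val \<A>"
proof -
  define \<Sigma> where "\<Sigma> = alphabet \<A>"
  obtain \<sigma> where "winning_strategy Val \<A> \<sigma>"
    using assms(2) unfolding history_deterministic_def by blast
  then have run: "run_from \<A> (initial \<A>) u (play \<sigma> [] u)"
    and win: "word_value Val \<A> u \<le> run_value Val (play \<sigma> [] u)" if "u \<in> lists \<Sigma>" for u
    using quant that
    by (auto simp: winning_strategy_iff_play quantitative_automaton_def is_run_def \<Sigma>_def)
  define end_of where "end_of u = end_state (initial \<A>) (play \<sigma> [] u)" for u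
  define val where "val u = run_value Val (play \<sigma> [] u)" for u
  have "finite (val ` lists \<Sigma>)"
  proof (rule finite_subset)
    show "val ` lists \<Sigma> \<subseteq>
        insert (Val []) ((\<lambda>t. ereal (of_rat (weight t))) ` transitions \<A>)"
      unfolding val_def using run_value_in[OF run_from_transitions[OF run]] by blast
  qed (simp add: finite_transitions quant)
  \<comment> \<open>\<open>val (best q)\<close> will be the V q of the introduction. A word is
    chosen, not just a value, since the strategy must be consulted at a concrete history.\<close>
  define is_best where "is_best q u \<longleftrightarrow> u \<in> lists \<Sigma> \<and> end_of u = q \<and>
    (\<forall>u'\<in>lists \<Sigma>. end_of u' = q \<longrightarrow> val u' \<odot> val u = val u')" for q u
  define best where "best q = (SOME u. is_best q u)" for q
  have "\<exists>u. is_best q u" if "q \<in> end_of ` lists \<Sigma>" for q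
  proof -
    let ?S = "val ` {u \<in> lists \<Sigma>. end_of u = q}"
    have "finite ?S"
      using \<open>finite (val ` lists \<Sigma>)\<close> by (rule rev_finite_subset) auto
    moreover have "?S \<noteq> {}"
      using that by auto
    ultimately have "\<exists>m\<in>?S. \<forall>s\<in>?S. s \<odot> m = s"
      by (rule finite_has_greatest)
    then show ?thesis by (auto simp: is_best_def)
  qed
  then have "is_best q (best q)" if "q \<in> end_of ` lists \<Sigma>" for q
    unfolding best_def using that by (meson someI_ex)
  then have best: "best q \<in> lists \<Sigma>" "end_of (best q) = q"
      "\<And>u. u \<in> lists \<Sigma> \<Longrightarrow> end_of u = q \<Longrightarrow> val u \<odot> val (best q) = val u"
    if "q \<in> end_of ` lists \<Sigma>" for q
    using that by (simp_all add: is_best_def)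
  define move where "move q a = \<sigma> (play \<sigma> [] (best q)) a" for q a
  \<comment> \<open>Only states reached by the strategy are kept, as \<open>best\<close> is
    meaningful only there.\<close>
  define \<B> :: "('a, 'q) automaton" where
    "\<B> = \<lparr>alphabet = \<Sigma>, states = end_of ` lists \<Sigma>, initial = initial \<A>,
      delta = \<lambda>q a. {(weight (move q a), target (move q a))}\<rparr>"
  have play_best: "play \<sigma> [] (best q @ [a]) = play \<sigma> [] (best q) @ [move q a]" for q a
    by (simp add: play_append move_def)
  have move: "move q a \<in> transitions \<A>" "source (move q a) = q" "letter (move q a) = a"
      "target (move q a) = end_of (best q @ [a])" "best q @ [a] \<in> lists \<Sigma>"
    if "q \<in> end_of ` lists \<Sigma>" "a \<in> \<Sigma>" for q a
  proof -
    show *: "best q @ [a] \<in> lists \<Sigma>"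
      using that best by auto
    from run[OF this] show "move q a \<in> transitions \<A>" "source (move q a) = q"
      "letter (move q a) = a"
      using best(2)[OF that(1)] by (auto simp: play_best run_from_append end_of_def)
    show "target (move q a) = end_of (best q @ [a])"
      by (simp add: end_of_def play_best)
  qed
  have end_in: "target (move q a) \<in> end_of ` lists \<Sigma>" if "q \<in> end_of ` lists \<Sigma>" "a \<in> \<Sigma>" for q a
    using move(4,5)[OF that] by blast
  have trans_eq: "transitions \<B> = {move q a | q a. q \<in> end_of ` lists \<Sigma> \<and> a \<in> \<Sigma>}"
  proof (intro equalityI subsetI)
    fix t assume "t \<in> transitions \<B>"
    then have t: "source t \<in> end_of ` lists \<Sigma>" "letter t \<in> \<Sigma>"
        "weight t = weight (move (source t) (letter t))"
        "target t = target (move (source t) (letter t))"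
      by (auto simp: transitions_def \<B>_def)
    then have "t = move (source t) (letter t)"
      using move(2,3)[OF t(1,2)] by (intro transition.expand) auto
    then show "t \<in> {move q a | q a. q \<in> end_of ` lists \<Sigma> \<and> a \<in> \<Sigma>}"
      using t(1,2) by blast
  next
    fix t assume "t \<in> {move q a | q a. q \<in> end_of ` lists \<Sigma> \<and> a \<in> \<Sigma>}"
    then show "t \<in> transitions \<B>"
      using move(2,3) by (fastforce simp: transitions_def \<B>_def)
  qed
  have trans: "transitions \<B> \<subseteq> transitions \<A>"
    using move(1) unfolding trans_eq by blast
  have init: "initial \<A> \<in> end_of ` lists \<Sigma>"
    by (rule rev_image_eqI[of "[]"]) (auto simp: end_of_def)
  have states: "end_of ` lists \<Sigma> \<subseteq> states \<A>"
  proof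
    fix q assume q: "q \<in> end_of ` lists \<Sigma>"
    obtain a where "a \<in> \<Sigma>"
      using quant by (auto simp: quantitative_automaton_def \<Sigma>_def)
    then show "q \<in> states \<A>"
      using move(1,2)[OF q] by (auto simp: transitions_def)
  qed
  have "quantitative_automaton \<B>"
    using quant init end_in finite_subset[OF states]
    by (auto simp: quantitative_automaton_def \<B>_def \<Sigma>_def)
  then have prune: "pruning_of \<B> \<A>"
    using trans states by (auto simp: pruning_of_def \<B>_def \<Sigma>_def)
  have det: "deterministic \<B>"
    by (auto simp: deterministic_def \<B>_def)
  \<comment> \<open>\<open>v\<close> is the value accumulated so far in \<open>\<B>\<close>, and the
    last premise is the invariant v \<sqsubseteq> V q. In the induction step \<open>\<rho>\<close>
    is first replaced by the strategy's own continuation after \<open>best q\<close>, which starts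
    with the move of \<open>\<B>\<close>; the induction hypothesis at the target of that move
    handles the rest.\<close>
  have simulate: "\<exists>\<rho>'. run_from \<B> q w \<rho>' \<and> v \<odot> run_value Val \<rho> \<le> v \<odot> run_value Val \<rho>'"
    if "q \<in> end_of ` lists \<Sigma>" "w \<in> lists \<Sigma>" "run_from \<A> q w \<rho>" "v \<odot> val (best q) = v"
    for q v w \<rho>
    using that
  proof (induction w arbitrary: q v \<rho>)
    case (Cons a w)
    let ?t = "move q a" and ?V = "val (best q)"
    let ?x = "ereal (of_rat (weight ?t))"
    have a: "a \<in> \<Sigma>" and w: "w \<in> lists \<Sigma>"
      using Cons.prems by auto
    note mv = move[OF Cons.prems(1) a]
    define \<rho>\<^sub>1 where "\<rho>\<^sub>1 = play \<sigma> (play \<sigma> [] (best q @ [a])) w"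
    have word: "best q @ a # w \<in> lists \<Sigma>"
      using mv(5) w by auto
    have play_eq: "play \<sigma> [] (best q @ a # w) = play \<sigma> [] (best q) @ ?t # \<rho>\<^sub>1"
      by (simp add: play_append move_def \<rho>\<^sub>1_def)
    have run1: "run_from \<A> (target ?t) w \<rho>\<^sub>1"
      using run[OF word] unfolding play_eq by (simp add: run_from_append)
    \<comment> \<open>Prefixing the play on \<open>best q\<close> turns \<open>\<rho>\<close> into a
      competitor of the strategy's play on the whole word.\<close>
    have "is_run \<A> (best q @ a # w) (play \<sigma> [] (best q) @ \<rho>)"
      using run[OF best(1)] best(2) Cons.prems
      by (simp add: is_run_def run_from_append end_of_def)
    then have "?V \<odot> run_value Val \<rho> \<le> word_value Val \<A> (best q @ a # w)"
      using word_value_upper[of \<A> _ _ Val] by (force simp: run_value_append val_def)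
    also have "\<dots> \<le> ?V \<odot> (?x \<odot> run_value Val \<rho>\<^sub>1)"
      using win[OF word] unfolding play_eq by (simp add: run_value_append run_value_Cons val_def)
    finally have "v \<odot> (?V \<odot> run_value Val \<rho>) \<le> v \<odot> (?V \<odot> (?x \<odot> run_value Val \<rho>\<^sub>1))"
      by (rule mono)
    \<comment> \<open>By the invariant \<open>v\<close> absorbs \<open>?V\<close>, which therefore
      vanishes from both sides.\<close>
    then have le1: "v \<odot> run_value Val \<rho> \<le> v \<odot> ?x \<odot> run_value Val \<rho>\<^sub>1"
      using Cons.prems(4) by (simp flip: assoc)
    have val_snoc: "val (best q @ [a]) = ?V \<odot> ?x"
      unfolding val_def play_best by (simp add: run_value_append run_value_Cons)
    \<comment> \<open>The word \<open>best q @ [a]\<close> is itself a history ending in the target,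
      so its value is \<sqsubseteq> the greatest one there; combining with \<open>v\<close> yields
      the invariant for the next state.\<close>
    have "?V \<odot> ?x \<odot> val (best (target ?t)) = ?V \<odot> ?x"
      using best(3)[OF end_in[OF Cons.prems(1) a] mv(5)] mv(4) val_snoc by simp
    then have "v \<odot> ?x \<odot> val (best (target ?t)) = v \<odot> ?x"
      using Cons.prems(4) assoc by metis
    from Cons.IH[OF end_in[OF Cons.prems(1) a] w run1 this]
    obtain \<rho>' where \<rho>': "run_from \<B> (target ?t) w \<rho>'"
      "v \<odot> ?x \<odot> run_value Val \<rho>\<^sub>1 \<le> v \<odot> ?x \<odot> run_value Val \<rho>'"
      by blast
    have "run_from \<B> q (a # w) (?t # \<rho>')"
      using \<rho>' mv(2,3) Cons.prems(1) a trans_eq by auto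
    moreover have "v \<odot> run_value Val \<rho> \<le> v \<odot> run_value Val (?t # \<rho>')"
      using le1 \<rho>'(2) by (simp add: run_value_Cons assoc)
    ultimately show ?case by blast
  qed auto
  have "word_value Val \<B> w = word_value Val \<A> w" if w: "w \<in> lists \<Sigma>" for w
  proof (rule antisym)
    have "is_run \<A> w \<pi>" if "is_run \<B> w \<pi>" for \<pi>
      using run_from_mono[OF _ trans] that by (simp add: is_run_def \<B>_def)
    then show "word_value Val \<B> w \<le> word_value Val \<A> w"
      unfolding word_value_def by (intro SUP_subset_mono) auto
    show "word_value Val \<A> w \<le> word_value Val \<B> w"
      unfolding word_value_def
    proof (rule SUP_mono)
      fix \<rho> assume "\<rho> \<in> {\<rho>. is_run \<A> w \<rho>}"
      then show "\<exists>\<rho>'\<in>{\<rho>. is_run \<B> w \<rho>}. run_value Val \<rho> \<le> run_value Val \<rho>'"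
        \<comment> \<open>The accumulated value starts at the unit \<open>Val []\<close>; the
          invariant holds initially because the empty word is a history ending in the initial
          state.\<close>
        using simulate[OF init w, of \<rho> "Val []"]
          best(3)[OF init, of "[]"]
        by (auto simp: is_run_def \<B>_def val_def end_of_def)
    qed
  qed
  then have "equivalent Val \<B> \<A>"
    by (auto simp: equivalent_def \<B>_def \<Sigma>_def)
  then show ?thesis
    using prune det unfolding determinizable_by_pruning_def by blast
qed

end

section \<open>The two instances and the equivalence\<close>

lemma selective_value_Inf: "selective_value Inf_val min"
proof
  show "Inf_val (r # rs) = min (ereal (of_rat r)) (Inf_val rs)" for r rs
    by (simp add: Inf_val_def lessThan_Suc_eq_insert_0 image_image inf_min)
\<comment> \<open>The infimum over no weights is the top element \<infinity>, the unit of
  \<open>min\<close>; dually for \<open>Sup_val\<close> and \<open>max\<close>.\<close>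
qed (auto simp: Inf_val_def min_def top_ereal_def)

lemma selective_value_Sup: "selective_value Sup_val max"
proof
  show "Sup_val (r # rs) = max (ereal (of_rat r)) (Sup_val rs)" for r rs
    by (simp add: Sup_val_def lessThan_Suc_eq_insert_0 image_image sup_max)
qed (auto simp: Sup_val_def max_def bot_ereal_def)

theorem theorem24:
  fixes \<A> :: "('a, 'q) automaton"
    and Val :: "rat list \<Rightarrow> ereal"
  assumes "Val \<in> {Inf_val, Sup_val}"
    and "quantitative_automaton \<A>"
  shows "history_deterministic Val \<A> \<longleftrightarrow> determinizable_by_pruning Val \<A>"
proof -
  obtain comb where "selective_value Val comb"
    using assms(1) selective_value_Inf selective_value_Sup by blast
  then interpret selective_value Val comb .
  show ?thesis
    using determinizable_by_pruning_if_history_deterministic[OF assms(2)]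
      history_deterministic_if_determinizable_by_pruning by blast
qed

end
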